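(* There is an infinite sequence $(G_n)_{n=1}^{\infty}$ of pairwise non-isomorphic finite degree $3$-critical graphs such that no $G_n$ contains a cycle of length $23$.
   Context: All graphs are finite and simple. A subgraph $H$ of a graph $G$ is proper if $H\neq G$. "Minimum degree $3$" for a forbidden subgraph may be read as "minimum degree at least $3$". A graph $G$ is called degree $3$-critical if, with $n$ denoting its number of vertices, it has exactly $2n-2$ edges and it has no proper induced subgraph of minimum degree $3$. "Contains a cycle of length $\ell$" means contains a (not necessarily induced) subgraph that is a cycle on $\ell$ vertices. *)

theory Defs
  imports "Graph_Theory.Graph_Theory"
begin

text \<open>
  A finite simple graph is a symmetric, loop-free, finite digraph without parallel arcs, i.e. the
  AFP locale \<open>pair_graph\<close>. An undirected edge \<open>{u, v}\<close> corresponds to the two arcs \<open>(u, v)\<close> and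
  \<open>(v, u)\<close>, so edges have to be counted as two-element sets. The degree of a vertex is its
  \<open>out_degree\<close>.
\<close>

definition uedges :: "'a pair_pre_digraph \<Rightarrow> 'a set set" where
  "uedges G = {{u, v} | u v. (u, v) \<in> parcs G}"

text \<open>Only meaningful for graphs with at least one vertex.\<close>

definition min_degree :: "'a pair_pre_digraph \<Rightarrow> nat" where
  "min_degree G = Min (out_degree (with_proj G) ` pverts G)"

text \<open>
  The null graph is an induced subgraph of every graph; it does not count as a graph of minimum
  degree at least 3. The edge count is stated over the integers because subtraction
  on the natural numbers truncates.
\<close>

definition degree_3_critical :: "'a pair_pre_digraph \<Rightarrow> bool" where
  "degree_3_critical G \<longleftrightarrow>
     pair_graph G \<and>
     int (card (uedges G)) = 2 * int (card (pverts G)) - 2 \<and>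
     \<not> (\<exists>H. induced_subgraph (with_proj H) (with_proj G) \<and> H \<noteq> G \<and>
            pverts H \<noteq> {} \<and> 3 \<le> min_degree H)"

text \<open>
  In a symmetric digraph \<open>cycle\<close> also holds of the closed walks \<open>u, v, u\<close> along a single edge;
  these are excluded by the bound on the length.
\<close>

definition contains_cycle_of_length :: "'a pair_pre_digraph \<Rightarrow> nat \<Rightarrow> bool" where
  "contains_cycle_of_length G l \<longleftrightarrow>
     3 \<le> l \<and> (\<exists>p. pre_digraph.cycle (with_proj G) p \<and> length p = l)"

end

theory Submission
  imports Defs "HOL-Library.Discrete_Functions"
begin

text \<open>
  Let \<open>T\<close> be a finite tree whose vertices have degree 1 or 3, and join two new adjacent vertices \<open>x\<close>,
  \<open>y\<close> to all leaves of \<open>T\<close>. Every vertex of \<open>T\<close> then has degree 3, so deleting any vertex destroys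
  all of \<open>T\<close> in a subgraph of minimum degree 3, and the edge count is right: the graph is degree
  3-critical. If all leaves of \<open>T\<close> lie in one class of its bipartition, then the graph without the
  edge \<open>xy\<close> is bipartite, so an odd cycle runs through \<open>xy\<close>, and a cycle of length 23 leaves a
  path of length 20 between two leaves of \<open>T\<close>. Hence it suffices to find infinitely many such trees
  without two leaves at distance 20. They arise by hanging perfect binary trees, whose depths repeat
  periodically, along a path.

  The vertices of \<open>T\<close> are numbered as in a heap: \<open>v\<close> has parent \<open>v div 2\<close>, so that \<open>floor_log\<close>
  provides the bipartition.
\<close>

section \<open>Binary trees at heap positions\<close>

datatype shape = Leaf | Node shape shape

primrec depths :: "shape \<Rightarrow> nat set" where
  "depths Leaf = {0}"
| "depths (Node l r) = Suc ` (depths l \<union> depths r)"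

primrec nodes :: "shape \<Rightarrow> nat \<Rightarrow> nat set" where
  "nodes Leaf i = {i}"
| "nodes (Node l r) i = insert i (nodes l (2 * i) \<union> nodes r (2 * i + 1))"

primrec leaves :: "shape \<Rightarrow> nat \<Rightarrow> nat set" where
  "leaves Leaf i = {i}"
| "leaves (Node l r) i = leaves l (2 * i) \<union> leaves r (2 * i + 1)"

text \<open>Leaves at depths \<open>a\<close> and \<open>b\<close> of the two subtrees are joined by
  a path of length \<open>a + b + 2\<close>, hence the value 18.\<close>

primrec no_leaf_path_20 :: "shape \<Rightarrow> bool" where
  "no_leaf_path_20 Leaf \<longleftrightarrow> True"
| "no_leaf_path_20 (Node l r) \<longleftrightarrow> no_leaf_path_20 l \<and> no_leaf_path_20 r \<and>
     (\<forall>a\<in>depths l. \<forall>b\<in>depths r. a + b \<noteq> 18)"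

section \<open>Ancestors as quotients by powers of two\<close>

lemma div_two_power_Suc:
  fixes v :: nat
  shows "v div 2 ^ Suc k = v div 2 ^ k div 2"
  unfolding power_Suc2 by (rule div_mult2_eq)

text \<open>Halving a number that is at least 2 lowers \<open>floor_log\<close> by one, and
  \<open>i > 0\<close> keeps all quotients before the last that large. So \<open>floor_log\<close>
  is the level in the heap.\<close>

lemma floor_log_ancestor:
  fixes v i :: nat
  assumes "v div 2 ^ k = i" "i > 0"
  shows "floor_log v = floor_log i + k"
  using assms
proof (induction k arbitrary: i)
  case (Suc k)
  have "v div 2 ^ k div 2 = i"
    using Suc.prems by (simp add: div_two_power_Suc del: power_Suc)
  moreover from this have "v div 2 ^ k \<ge> 2"
    using Suc.prems by linarith
  ultimately show ?case
    using Suc.IH[OF refl] floor_log_rec[of "v div 2 ^ k"] by simp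
qed simp

text \<open>Siblings lie on one level, so \<open>floor_log\<close> forces \<open>j = k\<close>, and
  the two quotients would coincide.\<close>

lemma children_no_common_descendant:
  fixes v i :: nat
  assumes "v div 2 ^ j = 2 * i" "v div 2 ^ k = 2 * i + 1" "i > 0"
  shows False
proof -
  have "floor_log (2 * i + 1) = floor_log (2 * i)"
    using assms(3) floor_log_rec[of "2 * i + 1"] by simp
  then have "j = k"
    using floor_log_ancestor[OF assms(1)] floor_log_ancestor[OF assms(2)] assms(3) by simp
  then show False
    using assms by simp
qed

section \<open>Vertices and leaves of a heap-numbered tree\<close>

lemma nodes_ancestor: "v \<in> nodes t i \<Longrightarrow> \<exists>k. v div 2 ^ k = i"
proof (induction t arbitrary: i)
  case Leaf
  then show ?case by (auto intro: exI[of _ 0])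
next
  case (Node l r)
  then consider "v = i" | k where "v div 2 ^ k = 2 * i" | k where "v div 2 ^ k = 2 * i + 1"
    by (auto simp del: One_nat_def add_Suc_right) blast+
  then show ?case
  proof cases
    case 1
    then show ?thesis by (auto intro: exI[of _ 0])
  next
    case 2
    then show ?thesis by (intro exI[of _ "Suc k"]) (simp add: div_two_power_Suc del: power_Suc)
  next
    case 3
    then show ?thesis by (intro exI[of _ "Suc k"]) (simp add: div_two_power_Suc del: power_Suc)
  qed
qed

lemma leaves_subset_nodes: "leaves t i \<subseteq> nodes t i"
proof (induction t arbitrary: i)
  case (Node l r)
  then show ?case using Node(1)[of "2 * i"] Node(2)[of "2 * i + 1"] by auto
qed simp

lemma leaf_ancestor: "v \<in> leaves t i \<Longrightarrow> \<exists>d\<in>depths t. v div 2 ^ d = i"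
proof (induction t arbitrary: i)
  case (Node l r)
  from Node.prems consider "v \<in> leaves l (2 * i)" | "v \<in> leaves r (2 * i + 1)" by auto
  then show ?case
  proof cases
    case 1
    then obtain d where "d \<in> depths l" "v div 2 ^ d = 2 * i" using Node.IH(1) by blast
    then show ?thesis by (intro bexI[of _ "Suc d"]) (simp_all add: div_two_power_Suc del: power_Suc)
  next
    case 2
    then obtain d where "d \<in> depths r" "v div 2 ^ d = 2 * i + 1" using Node.IH(2) by blast
    then show ?thesis by (intro bexI[of _ "Suc d"]) (simp_all add: div_two_power_Suc del: power_Suc)
  qed
qed simp

lemma nodes_children_disjoint:
  assumes "i > 0"
  shows "nodes l (2 * i) \<inter> nodes r (2 * i + 1) = {}"
proof (rule equals0I)
  fix v assume "v \<in> nodes l (2 * i) \<inter> nodes r (2 * i + 1)"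
  then obtain j k where "v div 2 ^ j = 2 * i" "v div 2 ^ k = 2 * i + 1"
    using nodes_ancestor[of v l "2 * i"] nodes_ancestor[of v r "2 * i + 1"] by blast
  then show False
    using children_no_common_descendant assms by metis
qed

lemma nodes_ge: "v \<in> nodes t i \<Longrightarrow> v \<ge> i"
  using nodes_ancestor[of v t i] by auto

lemma finite_nodes: "finite (nodes t i)"
  by (induction t arbitrary: i) auto

lemma finite_leaves: "finite (leaves t i)"
  by (induction t arbitrary: i) auto

text \<open>\<open>size\<close> counts the \<open>Node\<close> constructors only, that is, the inner
  vertices.\<close>

lemma card_nodes: "i > 0 \<Longrightarrow> card (nodes t i) = 2 * size t + 1"
proof (induction t arbitrary: i)
  case (Node l r)
  have "i \<notin> nodes l (2 * i) \<union> nodes r (2 * i + 1)"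
    using nodes_ge[of i l "2 * i"] nodes_ge[of i r "2 * i + 1"] Node.prems by auto
  then show ?case
    using Node.IH(1)[of "2 * i"] Node.IH(2)[of "2 * i + 1"] Node.prems
      nodes_children_disjoint[of i l r]
    by (simp add: card_Un_disjoint finite_nodes)
qed simp

lemma card_leaves: "i > 0 \<Longrightarrow> card (leaves t i) = size t + 1"
proof (induction t arbitrary: i)
  case (Node l r)
  have "leaves l (2 * i) \<inter> leaves r (2 * i + 1) = {}"
    using nodes_children_disjoint[of i l r] Node.prems
      leaves_subset_nodes[of l "2 * i"] leaves_subset_nodes[of r "2 * i + 1"] by blast
  then show ?case
    using Node.IH(1)[of "2 * i"] Node.IH(2)[of "2 * i + 1"] Node.prems
    by (simp add: card_Un_disjoint finite_leaves)
qed simp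

lemma nodes_root: "i \<in> nodes t i"
  by (cases t) auto

lemma nodes_parent: "v \<in> nodes t i \<Longrightarrow> v \<noteq> i \<Longrightarrow> v div 2 \<in> nodes t i"
proof (induction t arbitrary: i)
  case (Node l r)
  then consider "v \<in> nodes l (2 * i)" | "v \<in> nodes r (2 * i + 1)" by auto
  then show ?case
  proof cases
    case 1
    then show ?thesis using Node.IH(1)[of "2 * i"] by (cases "v = 2 * i") auto
  next
    case 2
    then show ?thesis using Node.IH(2)[of "2 * i + 1"] by (cases "v = 2 * i + 1") auto
  qed
qed simp

text \<open>A child of a leaf \<open>v\<close> descends from the root of the subtree containing
  \<open>v\<close>. Hence it is not in the sibling subtree, it is too large to be \<open>i\<close>,
  and the induction hypothesis excludes the subtree of \<open>v\<close>.\<close>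

lemma leaf_no_child:
  "v \<in> leaves t i \<Longrightarrow> w \<in> nodes t i \<Longrightarrow> i > 0 \<Longrightarrow> w div 2 \<noteq> v"
proof (induction t arbitrary: i)
  case (Node l r)
  show ?case
  proof
    assume child: "w div 2 = v"
    have up: "w div 2 ^ Suc k = v div 2 ^ k" for k
      using child by (simp add: div_mult2_eq)
    from Node.prems(1) consider "v \<in> leaves l (2 * i)" | "v \<in> leaves r (2 * i + 1)" by auto
    then show False
    proof cases
      case 1
      then obtain k where k: "w div 2 ^ Suc k = 2 * i"
        using leaf_ancestor[of v l] up by metis
      have "v \<ge> 2 * i"
        using 1 leaves_subset_nodes nodes_ge by blast
      then have "w \<noteq> i" using child Node.prems(3) by auto
      moreover have "w \<notin> nodes r (2 * i + 1)"
        using nodes_ancestor[of w r "2 * i + 1"] children_no_common_descendant[OF k _ Node.prems(3)]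
        by blast
      moreover have "w \<notin> nodes l (2 * i)"
        using Node.IH(1)[OF 1] child Node.prems(3) by auto
      ultimately show False using Node.prems(2) by simp
    next
      case 2
      then obtain k where k: "w div 2 ^ Suc k = 2 * i + 1"
        using leaf_ancestor[of v r] up by metis
      have "v \<ge> 2 * i + 1"
        using 2 leaves_subset_nodes nodes_ge by blast
      then have "w \<noteq> i" using child by auto
      moreover have "w \<notin> nodes l (2 * i)"
        using nodes_ancestor[of w l "2 * i"] children_no_common_descendant[OF _ k Node.prems(3)]
        by blast
      moreover have "w \<notin> nodes r (2 * i + 1)"
        using Node.IH(2)[OF 2] child by auto
      ultimately show False using Node.prems(2) by simp
    qed
  qed
qed auto

text \<open>The assumptions \<open>meet\<close> describe a lowest common ancestor; it has to be
  \<open>i\<close>. Comparing levels gives \<open>a + e = b + d\<close>. If \<open>a < d\<close>,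
  the paths have merged by the time they reach \<open>2 * i\<close> and \<open>2 * i + 1\<close>; if
  \<open>d < a\<close>, they have merged at \<open>i\<close>, before the supposed meeting
  point.\<close>

lemma leaf_distance_across:
  fixes u v i :: nat
  assumes u: "u div 2 ^ d = 2 * i" and v: "v div 2 ^ e = 2 * i + 1" and i: "i > 0"
    and meet: "u div 2 ^ Suc a = v div 2 ^ Suc b" "u div 2 ^ a \<noteq> v div 2 ^ b"
      "u div 2 ^ Suc a > 0"
  shows "a = d \<and> b = e"
proof -
  have logs: "floor_log u = floor_log i + Suc d" "floor_log v = floor_log i + Suc e"
    using floor_log_ancestor[OF u] floor_log_ancestor[OF v] i floor_log_rec[of "2 * i + 1"]
    by simp_all
  have "floor_log u = floor_log (u div 2 ^ Suc a) + Suc a"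
    "floor_log v = floor_log (u div 2 ^ Suc a) + Suc b"
    using floor_log_ancestor[of u "Suc a"] floor_log_ancestor[of v "Suc b"] meet by metis+
  then have eq: "a + e = b + d"
    using logs by linarith
  have shift: "x div 2 ^ (m + n) = x div 2 ^ m div 2 ^ n" for x m n :: nat
    by (simp add: power_add div_mult2_eq)
  have "\<not> a < d"
  proof
    assume "a < d"
    then have "u div 2 ^ d = u div 2 ^ Suc a div 2 ^ (d - Suc a)"
      "v div 2 ^ e = v div 2 ^ Suc b div 2 ^ (e - Suc b)"
      using shift[of u "Suc a" "d - Suc a"] shift[of v "Suc b" "e - Suc b"] eq
      by (simp_all del: power_Suc)
    moreover have "d - Suc a = e - Suc b" using eq by linarith
    ultimately show False using u v meet(1) by simp
  qed
  moreover have "\<not> d < a"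
  proof
    assume "d < a"
    then have "u div 2 ^ a = u div 2 ^ Suc d div 2 ^ (a - Suc d)"
      "v div 2 ^ b = v div 2 ^ Suc e div 2 ^ (b - Suc e)"
      using shift[of u "Suc d" "a - Suc d"] shift[of v "Suc e" "b - Suc e"] eq
      by (simp_all del: power_Suc)
    moreover have "u div 2 ^ Suc d = i" "v div 2 ^ Suc e = i"
      using u v by (simp_all add: div_two_power_Suc del: power_Suc)
    moreover have "a - Suc d = b - Suc e" using eq by linarith
    ultimately show False using meet(2) by simp
  qed
  ultimately show ?thesis using eq by linarith
qed

text \<open>The path from \<open>u\<close> up to the meeting point and down to \<open>v\<close> has
  length \<open>Suc a + Suc b\<close>. Leaves in the same subtree are covered by induction; for
  leaves in different subtrees, \<open>a\<close> and \<open>b\<close> are their depths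
  there.\<close>

lemma leaf_distance_not_20:
  assumes "no_leaf_path_20 t" "u \<in> leaves t i" "v \<in> leaves t i" "i > 0"
    and "u div 2 ^ Suc a = v div 2 ^ Suc b" "u div 2 ^ a \<noteq> v div 2 ^ b"
      "u div 2 ^ Suc a > 0"
  shows "a + b \<noteq> 18"
  using assms
proof (induction t arbitrary: i)
  case Leaf
  then have "u = v" by simp
  moreover from this have "a = b"
    using floor_log_ancestor[of u "Suc a"] floor_log_ancestor[of u "Suc b"] Leaf
    by (metis add_left_cancel nat.inject)
  ultimately show ?case using Leaf by simp
next
  case (Node l r)
  note meet = Node.prems(5-7)
  have meet_sym: "v div 2 ^ Suc b = u div 2 ^ Suc a" "v div 2 ^ b \<noteq> u div 2 ^ a"
      "v div 2 ^ Suc b > 0"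
    using meet by simp_all
  have across: "a' + b' \<noteq> 18"
    if u: "u' \<in> leaves l (2 * i)" and v: "v' \<in> leaves r (2 * i + 1)"
      and m: "u' div 2 ^ Suc a' = v' div 2 ^ Suc b'" "u' div 2 ^ a' \<noteq> v' div 2 ^ b'"
       "u' div 2 ^ Suc a' > 0"
    for u' v' a' b'
  proof -
    obtain d e where de: "d \<in> depths l" "u' div 2 ^ d = 2 * i"
      "e \<in> depths r" "v' div 2 ^ e = 2 * i + 1"
      using leaf_ancestor[OF u] leaf_ancestor[OF v] by blast
    then have "a' = d \<and> b' = e"
      using leaf_distance_across[OF de(2,4) Node.prems(4) m] by simp
    then show ?thesis using Node.prems(1) de(1,3) by auto
  qed
  have pos: "2 * i > 0" "2 * i + 1 > 0" using Node.prems(4) by simp_all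
  have ok: "no_leaf_path_20 l" "no_leaf_path_20 r" using Node.prems(1) by simp_all
  from Node.prems(2,3) consider
      "u \<in> leaves l (2 * i)" "v \<in> leaves l (2 * i)"
    | "u \<in> leaves r (2 * i + 1)" "v \<in> leaves r (2 * i + 1)"
    | "u \<in> leaves l (2 * i)" "v \<in> leaves r (2 * i + 1)"
    | "v \<in> leaves l (2 * i)" "u \<in> leaves r (2 * i + 1)"
    by auto
  then show ?case
  proof cases
    case 1
    then show ?thesis using Node.IH(1)[OF ok(1) _ _ pos(1) meet] by blast
  next
    case 2
    then show ?thesis using Node.IH(2)[OF ok(2) _ _ pos(2) meet] by blast
  next
    case 3
    then show ?thesis using across meet by blast
  next
    case 4
    then show ?thesis using across[OF _ _ meet_sym] by (simp add: add.commute)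
  qed
qed

text \<open>A path climbs, then descends: turning back upwards would repeat a vertex.\<close>

lemma path_shape:
  fixes g :: "nat \<Rightarrow> nat"
  assumes "\<And>i. i < n \<Longrightarrow> g (Suc i) = g i div 2 \<or> g i = g (Suc i) div 2"
    and "inj_on g {..n}"
  shows "\<exists>a b. a + b = n \<and> (\<forall>i\<le>a. g i = g 0 div 2 ^ i) \<and>
    (\<forall>i\<le>b. g (n - i) = g n div 2 ^ i)"
  using assms
proof (induction n)
  case 0
  then show ?case by (intro exI[of _ 0]) simp
next
  case (Suc n)
  have "inj_on g {..n}" using Suc.prems(2) by (rule inj_on_subset) auto
  then obtain a b where ab: "a + b = n" "\<forall>i\<le>a. g i = g 0 div 2 ^ i"
    "\<forall>i\<le>b. g (n - i) = g n div 2 ^ i"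
    using Suc.IH Suc.prems(1) by (metis less_Suc_eq)
  consider "g (Suc n) = g n div 2" | "g n = g (Suc n) div 2"
    using Suc.prems(1) by blast
  then show ?case
  proof cases
    case 1
    \<comment> \<open>Climbing after a descent would lead from \<open>g n\<close> to its parent,
      which is already \<open>g (n - 1)\<close>.\<close>
    have "b = 0"
    proof (rule ccontr)
      assume "b \<noteq> 0"
      then have "g (n - 1) = g (Suc n)" using ab(3) 1 by (auto dest: spec[of _ 1])
      then have "n - 1 = Suc n" using Suc.prems(2) by (auto dest: inj_onD)
      then show False by simp
    qed
    then have a: "a = n" using ab(1) by simp
    have "g i = g 0 div 2 ^ i" if "i \<le> Suc n" for i
    proof (cases "i = Suc n")
      case True
      have "g n = g 0 div 2 ^ n"
        using ab(2) a by blast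
      then show ?thesis
        using 1 True div_two_power_Suc[of "g 0" n] by metis
    next
      case False
      then have "i \<le> a"
        using that a by simp
      then show ?thesis
        using ab(2) by blast
    qed
    moreover have "g (Suc n - i) = g (Suc n) div 2 ^ i" if "i \<le> 0" for i
      using that by simp
    ultimately show ?thesis
      using add_0_right[of "Suc n"] by blast
  next
    case 2
    have "g (Suc n - i) = g (Suc n) div 2 ^ i" if "i \<le> Suc b" for i
    proof (cases i)
      case (Suc j)
      then have "g (Suc n - i) = g n div 2 ^ j"
        using ab(3) that by simp
      then have "g (Suc n - i) = g (Suc n) div 2 div 2 ^ j"
        using 2 by metis
      then show ?thesis using Suc by (simp add: div_mult2_eq)
    qed simp
    moreover have "a + Suc b = Suc n"
      using ab(1) by simp
    ultimately show ?thesis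
      using ab(2) by blast
  qed
qed

section \<open>The graph of a tree\<close>

text \<open>The root of a binary tree with at least one \<open>Node\<close> has only two neighbours;
  the extra leaf \<open>1\<close> above it supplies the third.\<close>

definition tree_vertices :: "shape \<Rightarrow> nat set" where
  "tree_vertices t = insert 1 (nodes t 3)"

definition tree_leaves :: "shape \<Rightarrow> nat set" where
  "tree_leaves t = insert 1 (leaves t 3)"

text \<open>
  The leaf \<open>1\<close> is the parent \<open>3 div 2\<close> of the root \<open>3\<close> of the binary tree. The two apices \<open>2\<close> and \<open>8\<close>
  are numbers that are not descendants of \<open>3\<close> and whose \<open>floor_log\<close> is odd.
\<close>

definition graph_arcs :: "shape \<Rightarrow> (nat \<times> nat) set" where
  "graph_arcs t =
     (\<lambda>v. (v, v div 2)) ` nodes t 3 \<union> tree_leaves t \<times> {2, 8} \<union> {(2, 8)}"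

definition graph_of :: "shape \<Rightarrow> nat pair_pre_digraph" where
  "graph_of t = \<lparr>pverts = tree_vertices t \<union> {2, 8}, parcs = graph_arcs t \<union> (graph_arcs t)\<inverse>\<rparr>"

lemma apex_not_below_3: "2 div 2 ^ k \<noteq> (3::nat)" "8 div 2 ^ k \<noteq> (3::nat)"
proof -
  have two: "2 div 2 ^ m \<noteq> (3::nat)" for m
    using div_le_dividend[of 2 "2 ^ m"] by linarith
  then show "2 div 2 ^ k \<noteq> (3::nat)" .
  consider "k = 0" | "k = 1" | m where "k = 2 + m"
    by (metis One_nat_def Suc_1 add_2_eq_Suc less_2_cases not_less_eq nat_le_iff_add not_less)
  then show "8 div 2 ^ k \<noteq> (3::nat)"
  proof cases
    case 3
    then show ?thesis using two[of m] by (simp only: power_add div_mult2_eq) simp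
  qed simp_all
qed

lemma apex_notin_nodes [simp]: "2 \<notin> nodes t 3" "8 \<notin> nodes t 3"
  using nodes_ancestor[of 2 t 3] nodes_ancestor[of 8 t 3] apex_not_below_3 by auto

lemma tree_vertex_simps [simp]:
  "2 \<notin> tree_vertices t" "8 \<notin> tree_vertices t" "0 \<notin> tree_vertices t"
  using nodes_ge[of 0 t 3] by (auto simp: tree_vertices_def)

lemma tree_leaves_subset: "tree_leaves t \<subseteq> tree_vertices t"
  using leaves_subset_nodes by (auto simp: tree_leaves_def tree_vertices_def)

lemma tree_parent: "v \<in> nodes t 3 \<Longrightarrow> v div 2 \<in> tree_vertices t"
  using nodes_parent[of v t 3] by (cases "v = 3") (auto simp: tree_vertices_def)

lemma nodes_3_ge: "v \<in> nodes t 3 \<Longrightarrow> 3 \<le> v"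
  by (rule nodes_ge)

lemma apex_notin_leaves [simp]: "2 \<notin> tree_leaves t" "8 \<notin> tree_leaves t"
  using tree_leaves_subset[of t] tree_vertex_simps[of t] by blast+

lemma apex_not_parent: "v \<in> nodes t 3 \<Longrightarrow> v div 2 \<noteq> 2 \<and> v div 2 \<noteq> 8"
  using tree_parent[of v t] tree_vertex_simps[of t] by metis

lemma graph_arcs_cases:
  assumes "(u, v) \<in> graph_arcs t"
  obtains (parent) "u \<in> nodes t 3" "v = u div 2"
    | (apex) "u \<in> tree_leaves t" "v \<in> {2, 8}"
    | (apices) "u = 2" "v = 8"
  using assms by (auto simp: graph_arcs_def)

text \<open>\<open>graph_arcs\<close> holds one orientation of each edge, so that edges can be
  counted as arcs. The case \<open>u = v\<close> excludes loops.\<close>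

lemma graph_arcs_antisym:
  assumes "(u, v) \<in> graph_arcs t"
  shows "(v, u) \<notin> graph_arcs t"
proof
  assume rev: "(v, u) \<in> graph_arcs t"
  from assms show False
  proof (cases rule: graph_arcs_cases)
    case parent
    from rev show False
    proof (cases rule: graph_arcs_cases)
      case parent': parent
      then show False using parent nodes_3_ge[of u t] by linarith
    qed (use parent apex_not_parent[of u t] in auto)
  next
    case apex
    from rev show False
      by (cases rule: graph_arcs_cases) (use apex in auto)
  next
    case apices
    from rev show False
      by (cases rule: graph_arcs_cases) (use apices in auto)
  qed
qed

lemma finite_tree_leaves: "finite (tree_leaves t)"
  by (simp add: tree_leaves_def finite_leaves)

lemma finite_graph_arcs: "finite (graph_arcs t)"
  by (simp add: graph_arcs_def finite_nodes finite_tree_leaves)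

lemma graph_arcs_verts:
  "(u, v) \<in> graph_arcs t \<Longrightarrow> u \<in> pverts (graph_of t) \<and> v \<in> pverts (graph_of t)"
  using tree_leaves_subset[of t] tree_parent[of _ t]
  by (auto simp: graph_arcs_def graph_of_def tree_vertices_def)

lemma graph_of_sym: "(u, v) \<in> parcs (graph_of t) \<Longrightarrow> (v, u) \<in> parcs (graph_of t)"
  by (auto simp: graph_of_def)

section \<open>Simplicity and edge count\<close>

lemma pair_graph_graph_of: "pair_graph (graph_of t)"
proof
  show "fst e \<in> pverts (graph_of t)" "snd e \<in> pverts (graph_of t)"
    if "e \<in> parcs (graph_of t)" for e
    using that graph_arcs_verts by (cases e; auto simp: graph_of_def)+
  show "finite (pverts (graph_of t))" "finite (parcs (graph_of t))"
    by (simp_all add: graph_of_def tree_vertices_def finite_nodes finite_graph_arcs)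
  show "fst e \<noteq> snd e" if "e \<in> parcs (graph_of t)" for e
    using that graph_arcs_antisym by (cases e) (auto simp: graph_of_def)
  show "symmetric (with_proj (graph_of t))"
    using graph_of_sym by (auto simp: symmetric_def intro!: symI)
qed

lemma card_pverts_graph_of: "card (pverts (graph_of t)) = 2 * size t + 4"
proof -
  have "1 \<notin> nodes t 3" using nodes_3_ge by force
  then show ?thesis
    by (simp add: graph_of_def tree_vertices_def finite_nodes card_nodes apex_notin_nodes)
qed

text \<open>With \<open>s = size t\<close> there are \<open>2 * s + 1\<close> edges to parents, two
  edges to the apices from each of the \<open>s + 2\<close> leaves, and the edge between the apices.
  The sum equals \<open>2 * (2 * s + 4) - 2\<close>.\<close>

lemma card_uedges_graph_of: "card (uedges (graph_of t)) = 4 * size t + 6"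
proof -
  have "uedges (graph_of t) = (\<lambda>(u, v). {u, v}) ` graph_arcs t"
    by (auto simp: uedges_def graph_of_def)
  moreover have "inj_on (\<lambda>(u, v). {u, v}) (graph_arcs t)"
    using graph_arcs_antisym by (auto simp: inj_on_def doubleton_eq_iff)
  ultimately have "card (uedges (graph_of t)) = card (graph_arcs t)"
    by (simp add: card_image)
  also have "\<dots> = card ((\<lambda>v. (v, v div 2)) ` nodes t 3) + card (tree_leaves t \<times> {2, 8::nat}) + 1"
  proof -
    have "((\<lambda>v. (v, v div 2)) ` nodes t 3) \<inter> (tree_leaves t \<times> {2, 8}) = {}"
      using apex_not_parent[of _ t] by auto
    moreover have "(2, 8) \<notin> (\<lambda>v. (v, v div 2)) ` nodes t 3 \<union> tree_leaves t \<times> {2, 8}"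
      by auto
    ultimately show ?thesis
      by (simp add: graph_arcs_def card_Un_disjoint finite_nodes finite_tree_leaves)
  qed
  also have "card ((\<lambda>v. (v, v div 2)) ` nodes t 3) = 2 * size t + 1"
    by (subst card_image) (auto simp: inj_on_def card_nodes)
  also have "card (tree_leaves t \<times> {2, 8::nat}) = 2 * (size t + 2)"
  proof -
    have "1 \<notin> leaves t 3" using nodes_3_ge leaves_subset_nodes by force
    then show ?thesis
      by (simp add: tree_leaves_def card_cartesian_product card_leaves finite_leaves)
  qed
  finally show ?thesis by simp
qed

section \<open>Absence of proper induced subgraphs of minimum degree 3\<close>

lemma leaf_no_child_node:
  assumes "v \<in> leaves t 3" "w \<in> nodes t 3"
  shows "w div 2 \<noteq> v"
  using leaf_no_child[OF assms] by simp

text \<open>A leaf has one tree neighbour and the two apices; an inner vertex has its parent and two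
  children. With this upper bound, a subgraph of minimum degree 3 must keep all neighbours of each
  tree vertex it contains.\<close>

lemma tree_vertex_neighbours:
  assumes "v \<in> tree_vertices t"
  shows "\<exists>N. card N \<le> 3 \<and> finite N \<and> (\<forall>w. (v, w) \<in> parcs (graph_of t) \<longrightarrow> w \<in> N)"
proof -
  have child: "w = 2 * v \<or> w = 2 * v + 1" if "w div 2 = v" for w
    using that by auto
  have arcs: "w = v div 2 \<and> v \<in> nodes t 3 \<or> w div 2 = v \<and> w \<in> nodes t 3
      \<or> v \<in> tree_leaves t \<and> w \<in> {2, 8}"
    if "(v, w) \<in> parcs (graph_of t)" for w
    using that assms tree_vertex_simps[of t] by (auto simp: graph_of_def graph_arcs_def)
  consider "v = 1" | "v \<in> leaves t 3" | "v \<notin> tree_leaves t"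
    by (auto simp: tree_leaves_def)
  then show ?thesis
  proof cases
    case 1
    have "w \<in> {3, 2, 8}" if "(v, w) \<in> parcs (graph_of t)" for w
      using arcs[OF that] child[of w] nodes_3_ge[of 1 t] apex_notin_nodes[of t] 1 by auto
    then show ?thesis by (intro exI[of _ "{3, 2, 8}"]) auto
  next
    case 2
    have "w \<in> {v div 2, 2, 8}" if "(v, w) \<in> parcs (graph_of t)" for w
      using arcs[OF that] leaf_no_child_node[OF 2] by auto
    then show ?thesis by (intro exI[of _ "{v div 2, 2, 8}"]) (auto simp: card_insert_if)
  next
    case 3
    have "w \<in> {v div 2, 2 * v, 2 * v + 1}" if "(v, w) \<in> parcs (graph_of t)" for w
      using arcs[OF that] child[of w] 3 by blast
    then show ?thesis by (intro exI[of _ "{v div 2, 2 * v, 2 * v + 1}"]) (auto simp: card_insert_if)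
  qed
qed

text \<open>Membership spreads from the root downwards, each vertex receiving it from its smaller
  parent.\<close>

lemma nodes_subset_if_closed:
  assumes "i \<in> U" "\<And>w. w \<in> nodes t i \<Longrightarrow> w \<noteq> i \<Longrightarrow> w div 2 \<in> U \<Longrightarrow> w \<in> U"
  shows "nodes t i \<subseteq> U"
proof
  fix w assume "w \<in> nodes t i"
  then show "w \<in> U"
  proof (induction w rule: less_induct)
    case (less w)
    show ?case
    proof (cases "w = i")
      case False
      moreover have "w div 2 < w"
        using False nodes_parent[OF less.prems False] nodes_ge[OF less.prems] by (cases w) auto
      ultimately show ?thesis
        using less nodes_parent[OF less.prems] assms(2) by blast
    qed (use assms in simp)
  qed
qed

text \<open>Repeated passage to the parent leads from any tree vertex to \<open>1\<close>.\<close>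

lemma one_in_if_parent_closed:
  assumes "v \<in> tree_vertices t \<inter> U" "\<And>w. w \<in> nodes t 3 \<Longrightarrow> w \<in> U \<Longrightarrow> w div 2 \<in> U"
  shows "1 \<in> U"
  using assms(1)
proof (induction v rule: less_induct)
  case (less v)
  show ?case
  proof (cases "v = 1")
    case False
    then have "v \<in> nodes t 3" using less.prems by (auto simp: tree_vertices_def)
    then show ?thesis
      using less.IH[of "v div 2"] less.prems assms(2) tree_parent nodes_3_ge[of v t] by auto
  qed (use less.prems in simp)
qed

text \<open>The two apices alone are too few, so \<open>H\<close> contains a tree vertex. Keeping
  all neighbours, \<open>H\<close> then contains \<open>1\<close>, from there the whole tree, and
  finally the apices.\<close>

lemma no_proper_induced_min_degree_3:
  assumes ind: "induced_subgraph (with_proj H) (with_proj (graph_of t))"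
    and ne: "pverts H \<noteq> {}" and deg: "3 \<le> min_degree H"
  shows "H = graph_of t"
proof -
  let ?G = "graph_of t" and ?U = "pverts H"
  interpret pair_graph ?G by (rule pair_graph_graph_of)
  have sub: "?U \<subseteq> pverts ?G"
    and arcs: "parcs H = {e \<in> parcs ?G. fst e \<in> ?U \<and> snd e \<in> ?U}"
    using ind by (auto simp: induced_subgraph_def subgraph_def)
  have fin: "finite ?U" using sub pair_finite_verts finite_subset by blast
  have three: "3 \<le> card {w. (v, w) \<in> parcs H}" if "v \<in> ?U" for v
  proof -
    have "out_arcs (with_proj H) v = Pair v ` {w. (v, w) \<in> parcs H}"
      by (auto simp: out_arcs_def)
    then have "out_degree (with_proj H) v = card {w. (v, w) \<in> parcs H}"
      by (simp add: out_degree_def card_image inj_on_def)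
    moreover have "min_degree H \<le> out_degree (with_proj H) v"
      unfolding min_degree_def using that fin by (intro Min_le) auto
    ultimately show ?thesis using deg by simp
  qed
  have closed: "w \<in> ?U" if v: "v \<in> tree_vertices t" "v \<in> ?U" and vw: "(v, w) \<in> parcs ?G" for v w
  proof -
    obtain N where N: "card N \<le> 3" "finite N" "\<forall>w. (v, w) \<in> parcs ?G \<longrightarrow> w \<in> N"
      using tree_vertex_neighbours[OF v(1)] by blast
    have "{w. (v, w) \<in> parcs H} \<subseteq> N" using N(3) arcs by auto
    \<comment> \<open>At least 3 neighbours inside a set of at most 3 candidates fill it.\<close>
    then have "{w. (v, w) \<in> parcs H} = N"
      using N(1,2) three[OF v(2)] by (intro card_subset_eq) (auto dest: card_mono[OF N(2)])
    then show ?thesis using N(3) vw arcs by auto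
  qed
  have "\<exists>v. v \<in> tree_vertices t \<inter> ?U"
  proof (rule ccontr)
    assume "\<not> ?thesis"
    then have U: "?U \<subseteq> {2, 8}" using sub by (auto simp: graph_of_def)
    obtain v where v: "v \<in> ?U" using ne by blast
    have "{w. (v, w) \<in> parcs H} \<subseteq> {2, 8}" using U arcs by auto
    then have "card {w. (v, w) \<in> parcs H} \<le> card {2, 8::nat}" by (intro card_mono) auto
    then show False using three[OF v] by simp
  qed
  then obtain v where v: "v \<in> tree_vertices t \<inter> ?U" by blast
  have one: "1 \<in> ?U"
  proof (rule one_in_if_parent_closed[OF v])
    show "w div 2 \<in> ?U" if "w \<in> nodes t 3" "w \<in> ?U" for w
      using that closed[of w "w div 2"] by (auto simp: tree_vertices_def graph_of_def graph_arcs_def)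
  qed
  have child: "w \<in> ?U" if "w \<in> nodes t 3" "w div 2 \<in> ?U" for w
    using that closed[of "w div 2" w] tree_parent[OF that(1)]
    by (auto simp: graph_of_def graph_arcs_def)
  have "3 \<in> ?U" using child[of 3] one nodes_root by simp
  then have "nodes t 3 \<subseteq> ?U" using child by (intro nodes_subset_if_closed) auto
  moreover have "2 \<in> ?U" "8 \<in> ?U"
    using closed[of 1] one by (auto simp: tree_vertices_def graph_of_def graph_arcs_def tree_leaves_def)
  ultimately have U: "?U = pverts ?G"
    using one sub by (auto simp: graph_of_def tree_vertices_def)
  moreover have "parcs H = parcs ?G"
    using arcs U in_arcsD1 in_arcsD2 by auto
  ultimately show ?thesis by simp
qed

lemma degree_3_critical_graph_of: "degree_3_critical (graph_of t)"
  unfolding degree_3_critical_def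
  using pair_graph_graph_of no_proper_induced_min_degree_3
  by (auto simp: card_pverts_graph_of card_uedges_graph_of)

section \<open>Cycles of length 23\<close>

lemma pcas_nth:
  "pcas u p v \<Longrightarrow> Suc i < length p \<Longrightarrow> fst (p ! Suc i) = snd (p ! i)"
  by (induction p arbitrary: u i; force simp: nth_Cons neq_Nil_conv split: nat.splits)

lemma pcas_ends:
  "pcas u p v \<Longrightarrow> p \<noteq> [] \<Longrightarrow> fst (hd p) = u \<and> snd (last p) = v"
  by (induction p arbitrary: u) auto

text \<open>Unrolling the cycle into a periodic sequence allows it to be read from any of its edges
  onwards.\<close>

lemma cycle_sequence:
  assumes "pre_digraph.cycle (with_proj G) p" "length p = l"
  obtains f where "\<And>i. (f i, f (Suc i)) \<in> parcs G"
    "\<And>i j. f i = f j \<longleftrightarrow> i mod l = j mod l"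
proof
  \<comment> \<open>The heads of the arcs form the tail of the vertex list, which is the part that
    \<open>cycle\<close> requires to be distinct.\<close>
  define f where "f i = snd (p ! (i mod l))" for i
  obtain u where p: "set p \<subseteq> parcs G" "pcas u p u" "p \<noteq> []"
      "distinct (tl (pre_digraph.awalk_verts (with_proj G) u p))"
    using assms(1) unfolding pre_digraph.cycle_def pre_digraph.awalk_def
    by (auto simp: cas_with_proj_eq)
  have l: "l > 0" using p(3) assms(2) by auto
  have "pre_digraph.awalk_verts (with_proj G) u p = fst (hd p) # map snd p"
    using pre_digraph.awalk_verts_conv'[of "with_proj G" u p u] p by (simp add: cas_with_proj_eq)
  then have dist: "distinct (map snd p)" using p(4) by simp
  show "f i = f j \<longleftrightarrow> i mod l = j mod l" for i j
    using nth_eq_iff_index_eq[OF dist, of "i mod l" "j mod l"] l assms(2) by (simp add: f_def)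
  show "(f i, f (Suc i)) \<in> parcs G" for i
  proof -
    let ?j = "Suc i mod l"
    have "fst (p ! ?j) = snd (p ! (i mod l))"
    proof (cases "Suc (i mod l) = l")
      case True
      then have "?j = 0" by (metis mod_Suc)
      moreover have "i mod l = length p - 1" using True assms(2) by simp
      ultimately show ?thesis
        using pcas_ends[OF p(2,3)] p(3) by (simp add: hd_conv_nth last_conv_nth)
    next
      case False
      then have "?j = Suc (i mod l)" by (simp add: mod_Suc)
      moreover have "Suc (i mod l) < length p"
        using False l assms(2) by (metis Suc_lessI mod_less_divisor)
      ultimately show ?thesis using pcas_nth[OF p(2)] by simp
    qed
    moreover have "p ! ?j \<in> parcs G" using p(1) l assms(2) nth_mem[of ?j p] by auto
    ultimately show ?thesis by (metis f_def prod.collapse)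
  qed
qed

text \<open>The root \<open>3\<close> is on level 1, so odd depths lead to even levels; the leaf
  \<open>1\<close> is on level 0.\<close>

lemma even_floor_log_leaf:
  assumes "\<forall>d\<in>depths t. odd d" "v \<in> tree_leaves t"
  shows "even (floor_log v)"
proof (cases "v = 1")
  case False
  then obtain d where "d \<in> depths t" "v div 2 ^ d = 3"
    using assms(2) leaf_ancestor[of v t 3] by (auto simp: tree_leaves_def)
  then show ?thesis
    using assms(1) floor_log_ancestor[of v d 3] floor_log_rec[of 3] by simp
qed simp

text \<open>The parity of the level is a proper 2-colouring of the graph without the edge between
  the apices, which lie on the odd levels 1 and 3.\<close>

lemma floor_log_arc_parity:
  assumes "\<forall>d\<in>depths t. odd d" "(u, v) \<in> parcs (graph_of t)" "{u, v} \<noteq> {2, 8}"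
  shows "even (floor_log u) \<longleftrightarrow> odd (floor_log v)"
proof -
  have log_apex: "odd (floor_log w)" if "w \<in> {2, 8}" for w
    using that floor_log_rec[of 2] floor_log_power[of 3] by auto
  have "even (floor_log u) \<longleftrightarrow> odd (floor_log v)"
    if "(u, v) \<in> graph_arcs t" "{u, v} \<noteq> {2, 8}" for u v
    using that(1)
  proof (cases rule: graph_arcs_cases)
    case parent
    then show ?thesis using floor_log_rec[of u] nodes_3_ge[of u t] by auto
  next
    case apex
    then show ?thesis using even_floor_log_leaf[OF assms(1)] log_apex by blast
  qed (use that in auto)
  then show ?thesis
    using assms(2,3) by (auto simp: graph_of_def insert_commute)
qed

section \<open>Paths of length 20 between leaves\<close>

lemma tree_arc_cases:
  assumes "(u, v) \<in> parcs (graph_of t)" "u \<in> tree_vertices t" "v \<in> tree_vertices t"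
  shows "v = u div 2 \<and> u \<in> nodes t 3 \<or> u = v div 2 \<and> v \<in> nodes t 3"
  using assms tree_vertex_simps[of t] by (auto simp: graph_of_def graph_arcs_def)

text \<open>A purely descending path starts at a leaf that has a child, which must be
  \<open>1\<close>. Its other end is 20 levels below \<open>1\<close>, hence at depth 19 below the
  root \<open>3\<close>.\<close>

lemma no_leaf_path_from_top:
  assumes "no_leaf_path_20 t" "19 \<notin> depths t"
    and u: "u \<in> tree_leaves t" and v: "v \<in> tree_leaves t"
    and anc: "u = v div 2 ^ 20" and w: "w \<in> nodes t 3" "w div 2 = u"
  shows False
proof (cases "u = 1")
  case True
  then have "v \<noteq> 1" using anc by auto
  then obtain d where d: "d \<in> depths t" "v div 2 ^ d = 3"
    using v leaf_ancestor[of v t 3] by (auto simp: tree_leaves_def)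
  have "floor_log v = 20" "floor_log v = 1 + d"
    using floor_log_ancestor[of v 20 1] floor_log_ancestor[of v d 3] floor_log_rec[of 3]
      True anc d by simp_all
  then have "d = 19" by simp
  then show False using d assms(2) by simp
next
  case False
  then show False using u w leaf_no_child_node by (auto simp: tree_leaves_def)
qed

lemma no_leaf_path:
  assumes t: "no_leaf_path_20 t" "19 \<notin> depths t"
    and ends: "g 0 \<in> tree_leaves t" "g 20 \<in> tree_leaves t"
    and arcs: "\<And>i. i < 20 \<Longrightarrow> (g i, g (Suc i)) \<in> parcs (graph_of t)"
    and verts: "\<And>i. i \<le> 20 \<Longrightarrow> g i \<in> tree_vertices t"
    and inj: "inj_on g {..20}"
  shows False
proof -
  have step: "g (Suc i) = g i div 2 \<and> g i \<in> nodes t 3 \<or> g i = g (Suc i) div 2 \<and> g (Suc i) \<in> nodes t 3"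
    if "i < 20" for i
    using tree_arc_cases[OF arcs[OF that]] verts[of i] verts[of "Suc i"] that by auto
  obtain a b where ab: "a + b = 20" "\<forall>i\<le>a. g i = g 0 div 2 ^ i"
    "\<forall>i\<le>b. g (20 - i) = g 20 div 2 ^ i"
    using path_shape[of 20 g] step inj by blast
  have meet: "g a = g 0 div 2 ^ a" "g a = g 20 div 2 ^ b"
  proof -
    have "20 - b = a" using ab(1) by simp
    then show "g a = g 0 div 2 ^ a" "g a = g 20 div 2 ^ b" using ab(2,3) by (blast, metis order_refl)
  qed
  have inj': "g i = g j \<longleftrightarrow> i = j" if "i \<le> 20" "j \<le> 20" for i j
    using inj that by (auto simp: inj_on_def)
  have pos: "g i > 0" if "i \<le> 20" for i
    using verts[OF that] tree_vertex_simps(3)[of t] by (metis gr0I)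
  show False
  proof (cases a)
    case 0
    then have "b = 20" using ab(1) by simp
    \<comment> \<open>This rules out the upward alternative in \<open>step\<close>: otherwise the
      positive number \<open>g 0\<close> would equal its own quotient by 4.\<close>
    have "g 1 \<noteq> g 0 div 2"
    proof
      assume "g 1 = g 0 div 2"
      moreover have "g 1 = g 20 div 2 ^ 19" "g 0 = g 20 div 2 ^ 20"
        using ab(3)[rule_format, of 19] ab(3)[rule_format, of 20] \<open>b = 20\<close> by simp_all
      ultimately have "g 0 = g 0 div 2 div 2"
        using div_two_power_Suc[of "g 20" 19] by simp
      then show False using pos[of 0] by simp
    qed
    then have "g 1 div 2 = g 0" "g 1 \<in> nodes t 3" using step[of 0] by auto
    then show False
      using no_leaf_path_from_top[OF t ends _ _] meet 0 \<open>b = 20\<close> by simp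
  next
    case (Suc a')
    note a = this
    show False
    proof (cases b)
      case 0
      then have "a = 20" using ab(1) by simp
      have "g 19 \<noteq> g 20 div 2"
      proof
        assume "g 19 = g 20 div 2"
        moreover have "g 19 = g 0 div 2 ^ 19" "g 20 = g 0 div 2 ^ 20"
          using ab(2)[rule_format, of 19] ab(2)[rule_format, of 20] \<open>a = 20\<close> by simp_all
        ultimately have "g 20 = g 20 div 2 div 2"
          using div_two_power_Suc[of "g 0" 19] by simp
        then show False using pos[of 20] by simp
      qed
      then have "g 19 div 2 = g 20" "g 19 \<in> nodes t 3" using step[of 19] by auto
      then show False
        using no_leaf_path_from_top[OF t ends(2,1)] meet 0 \<open>a = 20\<close> by simp
    next
      case (Suc b')
      have le: "a \<le> 20" "Suc a \<le> 20" using ab(1) Suc by simp_all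
      have one: "(1::nat) div 2 ^ Suc m = 0" for m
        using one_less_power[of "2::nat" "Suc m"] by (intro div_less) simp
      \<comment> \<open>Both ends lie strictly below the turning point, whereas all proper quotients
        of 1 are 0.\<close>
      have "g 0 \<noteq> 1"
        using meet(1) pos[OF le(1)] a one by (metis less_irrefl)
      moreover have "g 20 \<noteq> 1"
        using meet(2) pos[OF le(1)] Suc one by (metis less_irrefl)
      ultimately have lv: "g 0 \<in> leaves t 3" "g 20 \<in> leaves t 3"
        using ends by (auto simp: tree_leaves_def)
      have "g 0 div 2 ^ a' = g a'"
        using ab(2)[rule_format, of a'] a by simp
      moreover have "g 20 div 2 ^ b' = g (Suc a)"
      proof -
        have "20 - b' = Suc a" using ab(1) Suc by simp
        then show ?thesis using ab(3)[rule_format, of b'] Suc by simp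
      qed
      \<comment> \<open>The vertices just before and just after the turning point differ, so the
        turning point is the lowest common ancestor of the ends.\<close>
      moreover have "g a' \<noteq> g (Suc a)"
        using inj'[of a' "Suc a"] le a by simp
      ultimately have "g 0 div 2 ^ a' \<noteq> g 20 div 2 ^ b'" by simp
      then have "a' + b' \<noteq> 18"
        using leaf_distance_not_20[OF t(1) lv, of a' b'] meet pos[OF le(1)] a Suc by simp
      then show False using ab(1) a Suc by simp
    qed
  qed
qed

lemma mod_add_left_inj:
  fixes a b k n :: nat
  assumes "(k + a) mod n = (k + b) mod n" "a < n" "b < n"
  shows "a = b"
  using assms
proof (induction a b rule: linorder_wlog)
  case (le a b)
  then have "n dvd k + b - (k + a)"
    using mod_eq_dvd_iff_nat[of "k + a" "k + b" n] by simp
  then have "n dvd b - a" by simp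
  then show ?case using le by (auto dest: dvd_imp_le)
qed simp

lemma no_cycle_23:
  assumes t: "no_leaf_path_20 t" "\<forall>d\<in>depths t. odd d" "19 \<notin> depths t"
  shows "\<not> contains_cycle_of_length (graph_of t) 23"
proof
  let ?G = "graph_of t"
  assume "contains_cycle_of_length ?G 23"
  then obtain p where p: "pre_digraph.cycle (with_proj ?G) p" "length p = 23"
    by (auto simp: contains_cycle_of_length_def)
  obtain f where arc: "\<And>i. (f i, f (Suc i)) \<in> parcs ?G"
    and inj: "\<And>i j. f i = f j \<longleftrightarrow> i mod 23 = j mod 23"
    using cycle_sequence[OF p] by blast
  \<comment> \<open>Otherwise the colour would change 23 times, an odd number, on the way back to
    the start.\<close>
  have "\<exists>k. {f k, f (Suc k)} = {2, 8}"
  proof (rule ccontr)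
    assume "\<nexists>k. {f k, f (Suc k)} = {2, 8}"
    then have alt: "even (floor_log (f i)) \<longleftrightarrow> odd (floor_log (f (Suc i)))" for i
      using floor_log_arc_parity[OF t(2) arc] by blast
    have "even (floor_log (f i)) \<longleftrightarrow> (even i \<longleftrightarrow> even (floor_log (f 0)))" for i
    proof (induction i)
      case (Suc i)
      then show ?case using alt[of i] by auto
    qed simp
    from this[of 23] show False using inj[of 23 0] by simp
  qed
  then obtain k where k: "{f k, f (Suc k)} = {2, 8}" ..
  then have apices: "f k \<in> {2, 8}" "f (Suc k) \<in> {2, 8}" by blast+
  \<comment> \<open>The apices occupy positions \<open>k\<close> and \<open>k + 1\<close>; the other
    21 vertices form a path with 20 edges.\<close>
  define g where "g i = f (k + 2 + i)" for i
  have not_apex: "g i \<notin> {2, 8}" if "i \<le> 20" for i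
  proof -
    have "g i \<noteq> f (k + j)" if "j < 2" for j
      using mod_add_left_inj[of k "2 + i" 23 j] that \<open>i \<le> 20\<close> by (auto simp: g_def inj add.assoc)
    from this[of 0] this[of 1] have "g i \<notin> {f k, f (Suc k)}" by simp
    then show ?thesis unfolding k .
  qed
  have in_verts: "f i \<in> pverts ?G" for i
    using arc[of i] graph_arcs_verts by (auto simp: graph_of_def)
  have verts: "g i \<in> tree_vertices t" if "i \<le> 20" for i
    using not_apex[OF that] in_verts[of "k + 2 + i"] by (auto simp: g_def graph_of_def)
  have leaf: "u \<in> tree_leaves t" if "(u, v) \<in> parcs ?G" "v \<in> {2, 8}" "u \<in> tree_vertices t" for u v
    using that tree_vertex_simps[of t] apex_not_parent[of _ t]
    by (auto simp: graph_of_def graph_arcs_def)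
  show False
  proof (rule no_leaf_path[OF t(1,3), of g])
    show "g 0 \<in> tree_leaves t"
      using leaf[of "g 0" "f (Suc k)"] graph_of_sym[OF arc[of "Suc k"]] verts[of 0] apices
      by (simp add: g_def)
    have "f (Suc (k + 22)) = f k" using inj by simp
    then show "g 20 \<in> tree_leaves t"
      using leaf[of "g 20" "f k"] arc[of "k + 22"] verts[of 20] apices
      by (simp add: g_def add.commute)
    show "(g i, g (Suc i)) \<in> parcs ?G" for i
      using arc[of "k + 2 + i"] by (simp add: g_def)
    show "inj_on g {..20}"
    proof (rule inj_onI)
      fix i j :: nat assume "i \<in> {..20}" "j \<in> {..20}" "g i = g j"
      then have "(k + 2 + i) mod 23 = (k + 2 + j) mod 23" "i < 23" "j < 23"
        by (simp_all add: g_def inj)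
      then show "i = j" by (rule mod_add_left_inj)
    qed
  qed (use verts in auto)
qed

section \<open>Infinitely many trees\<close>

primrec perfect :: "nat \<Rightarrow> shape" where
  "perfect 0 = Leaf"
| "perfect (Suc n) = Node (perfect n) (perfect n)"

text \<open>The tree grows at the root: each step moves all earlier leaves one level down and adds
  leaves at depth \<open>e + 1\<close>.\<close>

definition grow :: "nat list \<Rightarrow> shape \<Rightarrow> shape" where
  "grow = fold (\<lambda>e t. Node t (perfect e))"

definition period :: "nat list" where
  "period = [1,0,3,2,1,6,5,4,5,6,1,2,3,0,1,0,7,8,5,4,5,8,7,0]"

text \<open>
  The period was found by a computer search. The depths \<open>1, 9, 11, 15\<close> below come back after one
  round of it.
\<close>

definition spine :: "nat \<Rightarrow> shape" where
  "spine n = (grow period ^^ n) (perfect 1)"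

text \<open>
  Only the parity of a depth above \<open>19\<close> matters, so the depths of a growing tree are recorded by
  their parity \<open>q\<close> and by a list of candidates for those at most \<open>19\<close>.
\<close>

definition depths_within :: "nat list \<Rightarrow> bool \<Rightarrow> shape \<Rightarrow> bool" where
  "depths_within S q t \<longleftrightarrow> no_leaf_path_20 t \<and>
     (\<forall>d\<in>depths t. (even d \<longleftrightarrow> q) \<and> (d < 20 \<longrightarrow> d \<in> set S))"

text \<open>Runs \<open>grow\<close> on the recorded data alone. The bound \<open>e \<le> 9\<close>
  keeps leaves of the hung tree at distance at most 18, the parity condition keeps all leaves in one
  class, and the filter drops depths that would pass 19.\<close>

fun admissible :: "nat list \<Rightarrow> bool \<Rightarrow> nat list \<Rightarrow> nat list \<Rightarrow> bool" where
  "admissible S q [] S' \<longleftrightarrow> set S \<subseteq> set S' \<and> \<not> q"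
| "admissible S q (e # es) S' \<longleftrightarrow> e \<le> 9 \<and> (even e \<longleftrightarrow> q) \<and> (\<forall>s\<in>set S. s + e \<noteq> 18) \<and>
     admissible (map Suc (filter (\<lambda>s. s < 19) (e # S))) (\<not> q) es S'"

lemma depths_perfect [simp]: "depths (perfect n) = {n}"
  by (induction n) auto

lemma no_leaf_path_20_perfect: "n \<le> 9 \<Longrightarrow> no_leaf_path_20 (perfect n)"
  by (induction n) auto

text \<open>A depth violating the sum condition is at most 18 and hence recorded in
  \<open>S\<close>. Since depths only increase, a discarded depth never returns to the range below
  20.\<close>

lemma depths_within_grow:
  "depths_within S q t \<Longrightarrow> admissible S q es S' \<Longrightarrow> depths_within S' False (grow es t)"
proof (induction es arbitrary: S q t)
  case Nil
  then show ?case by (auto simp: depths_within_def grow_def)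
next
  case (Cons e es)
  have "depths_within (map Suc (filter (\<lambda>s. s < 19) (e # S))) (\<not> q) (Node t (perfect e))"
    using Cons.prems no_leaf_path_20_perfect[of e] by (force simp: depths_within_def)
  then have "depths_within S' False (grow es (Node t (perfect e)))"
    using Cons.prems(2) by (intro Cons.IH) auto
  then show ?case by (simp add: grow_def)
qed

text \<open>The 24 entries alternate in parity, starting with an odd one, so after a full round all
  depths are odd again.\<close>

lemma admissible_period: "admissible [1, 9, 11, 15] False period [1, 9, 11, 15]"
  by (simp add: period_def)

lemma depths_within_spine: "depths_within [1, 9, 11, 15] False (spine n)"
proof (induction n)
  case 0
  show ?case by (simp add: spine_def depths_within_def)
next
  case (Suc n)
  then show ?case using depths_within_grow[OF _ admissible_period] by (simp add: spine_def)
qed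

lemma size_grow: "size t + length es \<le> size (grow es t)"
proof (induction es arbitrary: t)
  case (Cons e es)
  from Cons.IH[of "Node t (perfect e)"] show ?case by (simp add: grow_def)
qed (simp add: grow_def)

lemma strict_mono_size_spine: "strict_mono (\<lambda>n. size (spine n))"
  unfolding strict_mono_Suc_iff
proof
  fix n
  show "size (spine n) < size (spine (Suc n))"
    using size_grow[of "spine n" period] by (simp add: spine_def period_def)
qed

lemma card_verts_eq_if_digraph_iso:
  assumes "digraph_iso G H"
  shows "card (verts G) = card (verts H)"
  using assms by (auto simp: digraph_iso_def pre_digraph.digraph_isomorphism_def card_image)

theorem theorem1p2:
  shows "\<exists>G :: nat \<Rightarrow> nat pair_pre_digraph.
           (\<forall>n\<ge>1. degree_3_critical (G n)) \<and>
           (\<forall>m\<ge>1. \<forall>n\<ge>1. m \<noteq> n \<longrightarrow> \<not> digraph_iso (with_proj (G m)) (with_proj (G n))) \<and>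
           (\<forall>n\<ge>1. \<not> contains_cycle_of_length (G n) 23)"
proof (intro exI[of _ "\<lambda>n. graph_of (spine n)"] conjI allI impI)
  show "degree_3_critical (graph_of (spine n))" for n
    by (rule degree_3_critical_graph_of)
  show "\<not> digraph_iso (with_proj (graph_of (spine m))) (with_proj (graph_of (spine n)))"
    if "m \<noteq> n" for m n
  proof
    assume "digraph_iso (with_proj (graph_of (spine m))) (with_proj (graph_of (spine n)))"
    \<comment> \<open>Isomorphic graphs have equally many vertices, here
      \<open>2 * size t + 4\<close>.\<close>
    then have "size (spine m) = size (spine n)"
      using card_verts_eq_if_digraph_iso by (fastforce simp: card_pverts_graph_of)
    then show False
      using that strict_mono_eq[OF strict_mono_size_spine] by simp
  qed
  show "\<not> contains_cycle_of_length (graph_of (spine n)) 23" for n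
    \<comment> \<open>Depth 19 is below 20 but missing from the list of candidates, so it does not
      occur.\<close>
    using depths_within_spine[of n] by (intro no_cycle_23) (auto simp: depths_within_def)
qed

end
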